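(* Let $W$ be a Banach space with norm $\|\cdot\|_W$, $W_0\subseteq W$ an open set, $w_0\in W_0$, and let $\mathcal{F}_\varepsilon:W_0\to W$, $\varepsilon>0$, be a family of $C^1$-maps. Suppose that $$\|\mathcal{F}_\varepsilon(w_0)\|_W\to 0\quad\text{for }\varepsilon\to 0.$$ Further, suppose that there exists $\varepsilon_0>0$ such that (a) $\mathcal{F}_\varepsilon'(w_0)$ is Fredholm of index zero from $W$ into $W$ for all $\varepsilon\in(0,\varepsilon_0]$; (b) $\inf\{\|\mathcal{F}_\varepsilon'(w_0)w\|_W:\ \varepsilon\in(0,\varepsilon_0],\ w\in W,\ \|w\|_W=1\}=:\alpha>0$; (c) $\displaystyle\sup_{\|w\|_W\le 1}\|(\mathcal{F}_\varepsilon'(w_0+w_1)-\mathcal{F}_\varepsilon'(w_0))w\|_W\to 0$ for $\varepsilon+\|w_1\|_W\to 0$. Then there exist $\varepsilon_1\in(0,\varepsilon_0]$ and $\delta>0$ such that for all $\varepsilon\in(0,\varepsilon_1]$ there exists exactly one $w=w_\varepsilon\in W_0$ with $\mathcal{F}_\varepsilon(w)=0$ and $\|w-w_0\|_W\le\delta$. Moreover, $$\|w_\varepsilon-w_0\|_W\le\frac{2}{\alpha}\|\mathcal{F}_\varepsilon(w_0)\|_W.$$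
   Context: $\mathcal{F}_\varepsilon'(w)$ denotes the Fréchet derivative of $\mathcal{F}_\varepsilon$ at $w\in W_0$, a bounded linear operator from $W$ to $W$. In (c), the limit is over $\varepsilon>0$ and $w_1\in W$ with $w_0+w_1\in W_0$: for every $\eta>0$ there is $\rho>0$ such that the supremum is at most $\eta$ whenever $\varepsilon>0$, $w_0+w_1\in W_0$ and $\varepsilon+\|w_1\|_W\le\rho$. *)

theory Defs
  imports "HOL-Analysis.Analysis"
begin

definition finite_dim :: "'a::real_vector set \<Rightarrow> bool" where
  "finite_dim S \<longleftrightarrow> (\<exists>B. finite B \<and> S \<subseteq> span B)"

(* The classes of the elements of B span the quotient of the whole space by the subspace S
   if and only if span (S \<union> B) = UNIV. Hence finite_codim S says that this quotient has
   finite dimension, and codim S is its dimension, i.e. the least number of spanning classes. *)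

definition finite_codim :: "'a::real_vector set \<Rightarrow> bool" where
  "finite_codim S \<longleftrightarrow> (\<exists>B. finite B \<and> span (S \<union> B) = UNIV)"

definition codim :: "'a::real_vector set \<Rightarrow> nat" where
  "codim S = (LEAST n. \<exists>B. finite B \<and> card B = n \<and> span (S \<union> B) = UNIV)"

lemma codim_eq_card_complement_basis:
  fixes S B :: "'a::real_vector set"
  assumes S: "subspace S" and B: "independent B" "finite B"
    and int: "S \<inter> span B = {0}" and sp: "span (S \<union> B) = UNIV"
  shows "codim S = card B"
  unfolding codim_def
proof (rule Least_equality)
  show "\<exists>C. finite C \<and> card C = card B \<and> span (S \<union> C) = UNIV"
    using B sp by blast
next
  fix n assume "\<exists>C. finite C \<and> card C = n \<and> span (S \<union> C) = UNIV"
  then obtain C where C: "finite C" "card C = n" "span (S \<union> C) = UNIV" by blast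
  have ex: "\<exists>b. b \<in> span B \<and> x - b \<in> S" for x
  proof -
    have "x \<in> span (S \<union> B)" using sp by simp
    then obtain s b where "x = s + b" "s \<in> span S" "b \<in> span B"
      unfolding span_Un by blast
    moreover have "span S = S" using S span_eq_iff by blast
    ultimately have "b \<in> span B \<and> x - b \<in> S" by simp
    then show ?thesis by blast
  qed
  then obtain P where P: "\<And>x. P x \<in> span B" "\<And>x. x - P x \<in> S" by metis
  have uniq: "P x = b" if "b \<in> span B" "x - b \<in> S" for x b
  proof -
    have "(x - b) - (x - P x) \<in> S" by (rule subspace_diff[OF S that(2) P(2)])
    then have "P x - b \<in> S" by simp
    moreover have "P x - b \<in> span B" by (rule span_diff[OF P(1) that(1)])
    ultimately have "P x - b \<in> {0}" using int by blast
    then show ?thesis by simp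
  qed
  have lin: "linear P"
  proof (rule linearI)
    fix x y
    have "(x - P x) + (y - P y) \<in> S" by (rule subspace_add[OF S P(2) P(2)])
    then have "x + y - (P x + P y) \<in> S" by (simp add: add_diff_add)
    then show "P (x + y) = P x + P y" by (intro uniq[OF span_add[OF P(1) P(1)]])
  next
    fix c x
    have "c *\<^sub>R (x - P x) \<in> S" by (rule subspace_scale[OF S P(2)])
    then have "c *\<^sub>R x - c *\<^sub>R P x \<in> S" by (simp add: scaleR_diff_right)
    then show "P (c *\<^sub>R x) = c *\<^sub>R P x" by (intro uniq[OF span_scale[OF P(1)]])
  qed
  have "b \<in> span (P ` C)" if "b \<in> B" for b
  proof -
    have "b \<in> span (S \<union> C)" using C by simp
    then obtain s c where sc: "b = s + c" "s \<in> span S" "c \<in> span C"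
      unfolding span_Un by blast
    have "P b = b" by (rule uniq) (simp_all add: that span_base subspace_0[OF S])
    moreover have "s \<in> S" using sc S span_eq_iff by blast
    then have "P s = 0" by (intro uniq) (simp_all add: span_zero)
    moreover have "P b = P s + P c" unfolding sc(1) by (rule linear_add[OF lin])
    ultimately have "b = P c" by simp
    moreover have "P c \<in> span (P ` C)" unfolding linear_span_image[OF lin] using sc(3) by (rule imageI)
    ultimately show ?thesis by simp
  qed
  then have "card B \<le> card (P ` C)"
    using independent_span_bound[of "P ` C" B] B(1) C(1) by blast
  also have "\<dots> \<le> n" using C card_image_le by blast
  finally show "card B \<le> n" .
qed

(* The range of a bounded operator between Banach spaces is automatically closed if it has
   finite codimension, so closedness of the range is not required separately. *)

definition fredholm :: "('a::banach \<Rightarrow>\<^sub>L 'b::banach) \<Rightarrow> bool" where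
  "fredholm T \<longleftrightarrow> finite_dim {x. blinfun_apply T x = 0} \<and> finite_codim (range (blinfun_apply T))"

definition fredholm_index :: "('a::banach \<Rightarrow>\<^sub>L 'b::banach) \<Rightarrow> int" where
  "fredholm_index T = int (dim {x. blinfun_apply T x = 0}) - int (codim (range (blinfun_apply T)))"

end

theory Submission
  imports Defs
begin

text \<open>The zeros of \<open>F \<epsilon>\<close> near \<open>w0\<close> are found by the simplified Newton iteration
  \<open>x \<mapsto> x - T\<inverse> (F \<epsilon> x)\<close>, where \<open>T = F' \<epsilon> w0\<close> stays fixed. By (b), \<open>T\<close> expands norms at
  least by the factor \<open>\<alpha>\<close>, hence is injective, and Fredholm index zero turns injectivity into
  surjectivity (\<open>fredholm_index_zero_inj_imp_surj\<close>). So \<open>T\<inverse>\<close> exists and has norm at most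
  \<open>1 / \<alpha>\<close>, uniformly in \<open>\<epsilon>\<close>.

  Condition (c) with \<open>\<eta> = \<alpha> / 2\<close> provides a ball around \<open>w0\<close>, of a radius \<open>\<delta>\<close> that does not
  depend on \<open>\<epsilon>\<close>, on which \<open>F \<epsilon> - T\<close> has Lipschitz constant \<open>\<alpha> / 2\<close>. The iteration then has
  Lipschitz constant \<open>1 / 2\<close> there, and it maps the ball into itself as soon as
  \<open>\<parallel>F \<epsilon> w0\<parallel> \<le> \<alpha> \<delta> / 2\<close>, which holds for all small \<open>\<epsilon>\<close> because \<open>F \<epsilon> w0\<close> tends to 0. Banach's fixed point theorem
  gives a zero (\<open>near_isomorphism_has_zero\<close>). Uniqueness and the error bound both come from
  one inequality: on the ball, \<open>F \<epsilon>\<close> itself expands distances at least by the factor \<open>\<alpha> / 2\<close>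
  (\<open>near_isomorphism_expands\<close>).

  On the trivial space \<open>W = {0}\<close> there are no unit vectors and \<open>\<alpha> = \<infinity>\<close>. Any positive real
  constant then serves as lower bound for \<open>T\<close>, and the final estimate reads \<open>0 \<le> 0\<close>.\<close>

section \<open>Fredholm operators of index zero\<close>

lemma dim_zero_subspace: "dim {0::'a::real_vector} = 0"
proof -
  have "dim (span {} :: 'a set) = card ({} :: 'a set)"
    by (rule dim_span_eq_card_independent) (rule independent_empty)
  then show ?thesis by simp
qed

text \<open>The least number in the definition of \<open>codim\<close> is attained only if some finite complement
  exists at all; this is what \<open>finite_codim\<close> guarantees.\<close>

lemma codim_zero_imp_UNIV:
  assumes "subspace S" "finite_codim S" "codim S = 0"
  shows "S = UNIV"
proof -
  have "\<exists>n B. finite B \<and> card B = n \<and> span (S \<union> B) = UNIV"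
    using assms(2) unfolding finite_codim_def by blast
  then have "\<exists>B. finite B \<and> card B = codim S \<and> span (S \<union> B) = UNIV"
    unfolding codim_def by (rule LeastI_ex)
  then obtain B where "finite B" "card B = 0" "span (S \<union> B) = UNIV"
    using assms(3) by auto
  then have "span S = UNIV" by simp
  then show ?thesis using assms(1) span_eq_iff by blast
qed

lemma fredholm_index_zero_inj_imp_surj:
  fixes T :: "'a::banach \<Rightarrow>\<^sub>L 'b::banach"
  assumes "fredholm T" "fredholm_index T = 0"
    and "\<And>x. blinfun_apply T x = 0 \<Longrightarrow> x = 0"
  shows "surj (blinfun_apply T)"
proof -
  have lin: "linear (blinfun_apply T)"
    using blinfun.bounded_linear_right bounded_linear.linear by blast
  have "{x. blinfun_apply T x = 0} = {0}"
    using assms(3) by (auto simp: blinfun.zero_right)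
  then have "codim (range (blinfun_apply T)) = 0"
    using assms(2) by (simp add: fredholm_index_def dim_zero_subspace)
  moreover have "finite_codim (range (blinfun_apply T))"
    using assms(1) by (simp add: fredholm_def)
  moreover have "subspace (range (blinfun_apply T))"
    using linear_subspace_image[OF lin] subspace_UNIV by blast
  ultimately show ?thesis by (intro codim_zero_imp_UNIV)
qed

section \<open>Lower and upper operator bounds as extrema over unit vectors\<close>

text \<open>The supremum is one of reals, so that it bounds its elements only because they are bounded
  above, here by the operator norm.\<close>

lemma norm_blinfun_le_SUP:
  fixes A :: "'a::real_normed_vector \<Rightarrow>\<^sub>L 'b::real_normed_vector"
  assumes "(SUP w\<in>{w. norm w \<le> 1}. norm (blinfun_apply A w)) \<le> \<eta>"
  shows "norm A \<le> \<eta>"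
proof -
  have bdd: "bdd_above ((\<lambda>w. norm (blinfun_apply A w)) ` {w. norm w \<le> 1})"
  proof (rule bdd_aboveI2)
    fix w :: 'a assume "w \<in> {w. norm w \<le> 1}"
    then have "norm A * norm w \<le> norm A" by (simp add: mult_left_le)
    then show "norm (blinfun_apply A w) \<le> norm A"
      using norm_blinfun[of A w] by linarith
  qed
  have unit: "norm (blinfun_apply A w) \<le> \<eta>" if "norm w \<le> 1" for w
    using cSUP_upper[OF _ bdd, of w] that assms by simp
  have "0 \<le> \<eta>" using unit[of 0] by (simp add: blinfun.zero_right)
  then show ?thesis
  proof (rule norm_blinfun_bound)
    fix x
    show "norm (blinfun_apply A x) \<le> \<eta> * norm x"
    proof (cases "x = 0")
      case False
      have "norm (blinfun_apply A (x /\<^sub>R norm x)) \<le> \<eta>"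
        by (rule unit) (use False in simp)
      then show ?thesis
        using False by (simp add: blinfun.scaleR_right field_simps)
    qed (simp add: blinfun.zero_right)
  qed
qed

lemma blinfun_lower_bound_of_unit_vectors:
  fixes T :: "'a::real_normed_vector \<Rightarrow>\<^sub>L 'b::real_normed_vector"
  assumes "\<And>w. norm w = 1 \<Longrightarrow> a \<le> norm (blinfun_apply T w)"
  shows "a * norm x \<le> norm (blinfun_apply T x)"
proof (cases "x = 0")
  case False
  have "a \<le> norm (blinfun_apply T (x /\<^sub>R norm x))"
    by (rule assms) (use False in simp)
  then show ?thesis
    using False by (simp add: blinfun.scaleR_right field_simps)
qed simp

section \<open>Zeros of maps close to a linear isomorphism\<close>

text \<open>A perturbation with Lipschitz constant \<open>a / 2\<close> can destroy at most half of the expansion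
  factor \<open>a\<close> of \<open>T\<close>.\<close>

lemma near_isomorphism_expands:
  fixes T :: "'a::real_normed_vector \<Rightarrow>\<^sub>L 'b::real_normed_vector"
  assumes "a * norm (x - y) \<le> norm (blinfun_apply T (x - y))"
    and "norm ((f x - blinfun_apply T x) - (f y - blinfun_apply T y)) \<le> a / 2 * norm (x - y)"
  shows "a / 2 * norm (x - y) \<le> norm (f x - f y)"
proof -
  have "blinfun_apply T (x - y)
      = (f x - f y) - ((f x - blinfun_apply T x) - (f y - blinfun_apply T y))"
    by (simp add: blinfun.diff_right)
  then have "norm (blinfun_apply T (x - y))
      \<le> norm (f x - f y) + norm ((f x - blinfun_apply T x) - (f y - blinfun_apply T y))"
    by (metis norm_triangle_ineq4)
  then show ?thesis using assms by simp
qed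

text \<open>The simplified Newton map \<open>G x = x - T\<inverse> (f x)\<close> satisfies \<open>T (G x) = T x - f x\<close>. Hence
  differences of \<open>G\<close> are controlled by applying the lower bound of \<open>T\<close> to them, without any
  reference to \<open>T\<inverse>\<close> as a bounded operator.\<close>

lemma near_isomorphism_has_zero:
  fixes T :: "'a::banach \<Rightarrow>\<^sub>L 'b::real_normed_vector"
  assumes "0 < a" "0 < \<delta>" and surj: "surj (blinfun_apply T)"
    and below: "\<And>x. a * norm x \<le> norm (blinfun_apply T x)"
    and lip: "\<And>x y. x \<in> cball c \<delta> \<Longrightarrow> y \<in> cball c \<delta> \<Longrightarrow>
      norm ((f x - blinfun_apply T x) - (f y - blinfun_apply T y)) \<le> a / 2 * norm (x - y)"
    and small: "norm (f c) \<le> a / 2 * \<delta>"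
  obtains w where "w \<in> cball c \<delta>" "f w = 0"
proof -
  define S where "S = inv (blinfun_apply T)"
  have TS: "blinfun_apply T (S y) = y" for y
    unfolding S_def by (rule surj_f_inv_f[OF surj])
  define G where "G x = x - S (f x)" for x
  have contr: "dist (G x) (G y) \<le> 1 / 2 * dist x y"
    if "x \<in> cball c \<delta>" "y \<in> cball c \<delta>" for x y
  proof -
    have "blinfun_apply T (G x - G y)
        = - ((f x - blinfun_apply T x) - (f y - blinfun_apply T y))"
      by (simp add: G_def blinfun.diff_right TS)
    then have "a * norm (G x - G y)
        \<le> norm ((f x - blinfun_apply T x) - (f y - blinfun_apply T y))"
      using below[of "G x - G y"] by (metis norm_minus_cancel)
    also have "\<dots> \<le> a / 2 * norm (x - y)" by (rule lip[OF that])
    finally have "a * norm (G x - G y) \<le> a * (1 / 2 * norm (x - y))" by simp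
    then show ?thesis
      using \<open>0 < a\<close> unfolding dist_norm by (rule mult_left_le_imp_le)
  qed
  have step: "dist c (G c) \<le> \<delta> / 2"
  proof -
    have "a * norm (S (f c)) \<le> a * (\<delta> / 2)"
      using below[of "S (f c)"] small by (simp add: TS)
    then have "norm (S (f c)) \<le> \<delta> / 2"
      using \<open>0 < a\<close> by (rule mult_left_le_imp_le)
    then show ?thesis by (simp add: G_def dist_norm)
  qed
  have maps: "G ` cball c \<delta> \<subseteq> cball c \<delta>"
  proof (rule image_subsetI)
    fix x assume x: "x \<in> cball c \<delta>"
    have "dist (G c) (G x) \<le> 1 / 2 * dist c x"
      by (rule contr) (use x \<open>0 < \<delta>\<close> in auto)
    then have "dist (G c) (G x) \<le> \<delta> / 2" using x by simp
    then show "G x \<in> cball c \<delta>"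
      using step dist_triangle[of c "G x" "G c"] by simp
  qed
  have "\<exists>!x\<in>cball c \<delta>. G x = x"
  proof (rule Banach_fix[where c = "1 / 2"])
    show "complete (cball c \<delta>)" by (simp add: complete_eq_closed)
    show "cball c \<delta> \<noteq> {}" using \<open>0 < \<delta>\<close> by simp
  qed (use maps contr in auto)
  then obtain w where w: "w \<in> cball c \<delta>" "G w = w" by blast
  then have "S (f w) = 0" by (simp add: G_def)
  then have "f w = 0" using TS[of "f w"] by (simp add: blinfun.zero_right)
  with w(1) show thesis by (rule that)
qed

section \<open>The implicit function theorem\<close>

theorem theorem2p1:
  fixes W0 :: "'a::banach set" and w0 :: 'a
    and F :: "real \<Rightarrow> 'a \<Rightarrow> 'a"
    and F' :: "real \<Rightarrow> 'a \<Rightarrow> 'a \<Rightarrow>\<^sub>L 'a"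
    and \<epsilon>0 :: real and \<alpha> :: ereal
  assumes "open W0" and "w0 \<in> W0"
    and "\<And>\<epsilon> w. 0 < \<epsilon> \<Longrightarrow> w \<in> W0 \<Longrightarrow> (F \<epsilon> has_derivative blinfun_apply (F' \<epsilon> w)) (at w)"
    and "\<And>\<epsilon>. 0 < \<epsilon> \<Longrightarrow> continuous_on W0 (F' \<epsilon>)"
    and "((\<lambda>\<epsilon>. norm (F \<epsilon> w0)) \<longlongrightarrow> 0) (at_right 0)"
    and "0 < \<epsilon>0"
    and "\<And>\<epsilon>. \<epsilon> \<in> {0<..\<epsilon>0} \<Longrightarrow> fredholm (F' \<epsilon> w0) \<and> fredholm_index (F' \<epsilon> w0) = 0"
    and "\<alpha> = Inf {ereal (norm (blinfun_apply (F' \<epsilon> w0) w)) | \<epsilon> w. \<epsilon> \<in> {0<..\<epsilon>0} \<and> norm w = 1}"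
    and "0 < \<alpha>"
    and "\<And>\<eta>. 0 < \<eta> \<Longrightarrow> \<exists>\<rho>>0. \<forall>\<epsilon> w1. 0 < \<epsilon> \<and> w0 + w1 \<in> W0 \<and> \<epsilon> + norm w1 \<le> \<rho> \<longrightarrow>
           (SUP w\<in>{w. norm w \<le> 1}. norm (blinfun_apply (F' \<epsilon> (w0 + w1) - F' \<epsilon> w0) w)) \<le> (\<eta>::real)"
  shows "\<exists>\<epsilon>1\<in>{0<..\<epsilon>0}. \<exists>\<delta>>0. \<forall>\<epsilon>\<in>{0<..\<epsilon>1}.
           (\<exists>!w. w \<in> W0 \<and> F \<epsilon> w = 0 \<and> norm (w - w0) \<le> \<delta>) \<and>
           (\<forall>w. w \<in> W0 \<and> F \<epsilon> w = 0 \<and> norm (w - w0) \<le> \<delta> \<longrightarrow>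
                ereal (norm (w - w0)) \<le> 2 / \<alpha> * ereal (norm (F \<epsilon> w0)))"
proof -
  \<comment> \<open>\<open>\<alpha> = \<infinity>\<close> means that there are no unit vectors, so that 1 is as good a lower bound as any.\<close>
  define a where "a = (if \<alpha> = \<infinity> then 1 else real_of_ereal \<alpha>)"
  have "0 < a" using \<open>0 < \<alpha>\<close> unfolding a_def by (cases \<alpha>) auto
  have "ereal a \<le> \<alpha>" using \<open>0 < \<alpha>\<close> unfolding a_def by (cases \<alpha>) auto
  have below: "a * norm x \<le> norm (blinfun_apply (F' \<epsilon> w0) x)"
    if "\<epsilon> \<in> {0<..\<epsilon>0}" for \<epsilon> x
  proof (rule blinfun_lower_bound_of_unit_vectors)
    fix w :: 'a assume "norm w = 1"
    then have "\<alpha> \<le> ereal (norm (blinfun_apply (F' \<epsilon> w0) w))"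
      unfolding assms(8) using that by (intro Inf_lower) auto
    then have "ereal a \<le> ereal (norm (blinfun_apply (F' \<epsilon> w0) w))"
      using \<open>ereal a \<le> \<alpha>\<close> by (rule order_trans[rotated])
    then show "a \<le> norm (blinfun_apply (F' \<epsilon> w0) w)" by simp
  qed
  have surj: "surj (blinfun_apply (F' \<epsilon> w0))" if "\<epsilon> \<in> {0<..\<epsilon>0}" for \<epsilon>
  proof (rule fredholm_index_zero_inj_imp_surj)
    fix x assume "blinfun_apply (F' \<epsilon> w0) x = 0"
    then have "a * norm x \<le> 0" using below[OF that, of x] by simp
    then show "x = 0" using \<open>0 < a\<close> by (simp add: mult_le_0_iff)
  qed (use assms(7)[OF that] in auto)

  obtain \<rho> where "0 < \<rho>" and "\<forall>\<epsilon> v. 0 < \<epsilon> \<and> w0 + v \<in> W0 \<and> \<epsilon> + norm v \<le> \<rho> \<longrightarrow>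
      (SUP w\<in>{w. norm w \<le> 1}. norm (blinfun_apply (F' \<epsilon> (w0 + v) - F' \<epsilon> w0) w)) \<le> a / 2"
    using assms(10)[OF half_gt_zero[OF \<open>0 < a\<close>]] by blast
  then have \<rho>: "norm (F' \<epsilon> (w0 + v) - F' \<epsilon> w0) \<le> a / 2"
    if "0 < \<epsilon>" "w0 + v \<in> W0" "\<epsilon> + norm v \<le> \<rho>" for \<epsilon> v
    using that by (intro norm_blinfun_le_SUP) blast
  obtain r where "0 < r" and r: "cball w0 r \<subseteq> W0"
    using \<open>open W0\<close> \<open>w0 \<in> W0\<close> open_contains_cball by blast
  \<comment> \<open>The budget \<open>\<rho>\<close> for \<open>\<epsilon> + \<parallel>w1\<parallel>\<close> in (c) is split evenly between the two.\<close>
  define \<delta> where "\<delta> = min r (\<rho> / 2)"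
  have "0 < \<delta>" using \<open>0 < r\<close> \<open>0 < \<rho>\<close> by (simp add: \<delta>_def)
  have ball: "cball w0 \<delta> \<subseteq> W0" using r by (auto simp: \<delta>_def)
  have "\<forall>\<^sub>F \<epsilon> in at_right 0. norm (F \<epsilon> w0) < a / 2 * \<delta>"
    using assms(5) \<open>0 < a\<close> \<open>0 < \<delta>\<close> by (intro order_tendstoD(2)) auto
  then obtain b where "0 < b"
    and b: "\<And>\<epsilon>. 0 < \<epsilon> \<Longrightarrow> \<epsilon> < b \<Longrightarrow> norm (F \<epsilon> w0) < a / 2 * \<delta>"
    unfolding eventually_at_right_field by auto
  define \<epsilon>1 where "\<epsilon>1 = Min {\<epsilon>0, \<rho> / 2, b / 2}"
  have "\<epsilon>1 \<in> {0<..\<epsilon>0}"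
    using \<open>0 < \<epsilon>0\<close> \<open>0 < \<rho>\<close> \<open>0 < b\<close> by (simp add: \<epsilon>1_def)

  show ?thesis
  proof (intro bexI[OF _ \<open>\<epsilon>1 \<in> {0<..\<epsilon>0}\<close>] exI[of _ \<delta>] conjI \<open>0 < \<delta>\<close> ballI)
    fix \<epsilon> assume "\<epsilon> \<in> {0<..\<epsilon>1}"
    then have "0 < \<epsilon>" and \<epsilon>: "\<epsilon> \<in> {0<..\<epsilon>0}" "\<epsilon> \<le> \<rho> / 2" "\<epsilon> < b"
      using \<open>0 < b\<close> by (auto simp: \<epsilon>1_def)
    let ?T = "blinfun_apply (F' \<epsilon> w0)"
    have lip: "norm ((F \<epsilon> x - ?T x) - (F \<epsilon> y - ?T y)) \<le> a / 2 * norm (x - y)"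
      if "x \<in> cball w0 \<delta>" "y \<in> cball w0 \<delta>" for x y
    proof (rule differentiable_bound[where S = "cball w0 \<delta>"
          and f = "\<lambda>z. F \<epsilon> z - ?T z" and f' = "\<lambda>z. blinfun_apply (F' \<epsilon> z - F' \<epsilon> w0)"])
      fix z assume z: "z \<in> cball w0 \<delta>"
      have "(F \<epsilon> has_derivative blinfun_apply (F' \<epsilon> z)) (at z within cball w0 \<delta>)"
        using z ball assms(3)[OF \<open>0 < \<epsilon>\<close>] by (blast intro: has_derivative_at_withinI)
      moreover have "(?T has_derivative ?T) (at z within cball w0 \<delta>)"
        by (rule bounded_linear_imp_has_derivative) (rule blinfun.bounded_linear_right)
      ultimately show "((\<lambda>z. F \<epsilon> z - ?T z) has_derivative blinfun_apply (F' \<epsilon> z - F' \<epsilon> w0))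
          (at z within cball w0 \<delta>)"
        unfolding blinfun.diff_left by (rule has_derivative_diff)
      have "norm (F' \<epsilon> (w0 + (z - w0)) - F' \<epsilon> w0) \<le> a / 2"
        using z ball \<epsilon>(2) by (intro \<rho> \<open>0 < \<epsilon>\<close>) (auto simp: \<delta>_def dist_norm norm_minus_commute)
      then show "onorm (blinfun_apply (F' \<epsilon> z - F' \<epsilon> w0)) \<le> a / 2"
        by (simp add: norm_blinfun.rep_eq)
    qed (use that in auto)
    have expand: "a / 2 * norm (x - y) \<le> norm (F \<epsilon> x - F \<epsilon> y)"
      if "x \<in> cball w0 \<delta>" "y \<in> cball w0 \<delta>" for x y
      by (rule near_isomorphism_expands[OF below[OF \<epsilon>(1)] lip[OF that]])
    have in_ball: "x \<in> cball w0 \<delta> \<longleftrightarrow> norm (x - w0) \<le> \<delta>" for x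
      by (simp add: dist_norm norm_minus_commute)

    have "norm (F \<epsilon> w0) \<le> a / 2 * \<delta>" using b[OF \<open>0 < \<epsilon>\<close> \<epsilon>(3)] by simp
    then obtain w where w: "w \<in> cball w0 \<delta>" "F \<epsilon> w = 0"
      using near_isomorphism_has_zero[OF \<open>0 < a\<close> \<open>0 < \<delta>\<close> surj[OF \<epsilon>(1)] below[OF \<epsilon>(1)] lip]
      by blast
    show "\<exists>!w. w \<in> W0 \<and> F \<epsilon> w = 0 \<and> norm (w - w0) \<le> \<delta>"
    proof (rule ex1I[of _ w])
      show "w \<in> W0 \<and> F \<epsilon> w = 0 \<and> norm (w - w0) \<le> \<delta>"
        using w ball in_ball by blast
      fix v assume "v \<in> W0 \<and> F \<epsilon> v = 0 \<and> norm (v - w0) \<le> \<delta>"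
      then have "a / 2 * norm (v - w) \<le> 0"
        using expand[of v w] w in_ball by simp
      then show "v = w" using \<open>0 < a\<close> by (simp add: mult_le_0_iff)
    qed

    show "\<forall>w. w \<in> W0 \<and> F \<epsilon> w = 0 \<and> norm (w - w0) \<le> \<delta> \<longrightarrow>
        ereal (norm (w - w0)) \<le> 2 / \<alpha> * ereal (norm (F \<epsilon> w0))"
    proof (intro allI impI)
      fix w assume "w \<in> W0 \<and> F \<epsilon> w = 0 \<and> norm (w - w0) \<le> \<delta>"
      then have "a / 2 * norm (w - w0) \<le> norm (F \<epsilon> w0)"
        using expand[of w w0] in_ball \<open>0 < \<delta>\<close> by simp
      then have est: "norm (w - w0) \<le> 2 / a * norm (F \<epsilon> w0)"
        using \<open>0 < a\<close> by (simp add: field_simps)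
      show "ereal (norm (w - w0)) \<le> 2 / \<alpha> * ereal (norm (F \<epsilon> w0))"
      proof (cases "\<alpha> = \<infinity>")
        case True
        \<comment> \<open>A unit vector would make the infimum finite, so that all vectors vanish.\<close>
        have "w - w0 = 0"
        proof (rule ccontr)
          assume "w - w0 \<noteq> 0"
          then have "norm ((w - w0) /\<^sub>R norm (w - w0)) = 1" by simp
          then have "\<alpha> \<le> ereal (norm (?T ((w - w0) /\<^sub>R norm (w - w0))))"
            unfolding assms(8) using \<epsilon>(1) by (intro Inf_lower) blast
          then show False using True by simp
        qed
        then show ?thesis using True by simp
      next
        case False
        then have "\<alpha> = ereal a" using \<open>0 < \<alpha>\<close> unfolding a_def by (cases \<alpha>) auto
        then have "2 / \<alpha> = ereal (2 / a)"
          using \<open>0 < a\<close> by (metis ereal_divide numeral_eq_ereal order_less_irrefl)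
        then show ?thesis using est by simp
      qed
    qed
  qed
qed

end
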